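(* Let $R$ be a finite commutative associative ring (with unit) with a generating character $c:R\to T$, let $s,n\ge1$ be integers, and let $P\subset\mathbb{X}_n^s=M_{s,n}(R)$ be an $R$-submodule. Then the isomorphism of abelian groups $$\theta_c:\mathbb{X}_n^s\to\mathbb{K}_n^s$$ obtained by applying $\theta_c:R\to R^*$, $x\mapsto c(x\cdot(-))$, to each component restricts to an isomorphism $P^\vee\to P^\perp$.
   Context: $T=\{z\in\mathbb{C}:|z|=1\}$. For the additive group of $R$, $R^*=\mathrm{Hom}(R,T)$ is the character group. A finite commutative ring $R$ has a generating character if there is a character $c:R\to T$ of the additive group such that $\theta_c:R\to R^*$, $x\mapsto c(x\cdot(-))$ (i.e. $\theta_c(x)(y)=c(xy)$) is an isomorphism of abelian groups; such a $c$ is called a generating character. $\mathbb{X}_n:=R^n$, and $\mathbb{X}_n^s$ is identified with $s\times n$ matrices $X=(x_{i,j})$ over $R$; $\mathbb{K}_n^s$ is identified with $s\times n$ matrices $K=(\kappa_{i,j})$ over $R^*$; $K\bullet X:=\prod_{i,j}\kappa_{i,j}(x_{i,j})\in T$. The character-theoretic dual is $P^\perp:=\{K\in\mathbb{K}_n^s:K\bullet X=1\text{ for all }X\in P\}$. The ring-theoretic dual is $P^\vee:=\{X'=(x'_{i,j})\in\mathbb{X}_n^s:\sum_{i,j}x'_{i,j}x_{i,j}=0\text{ for all }X=(x_{i,j})\in P\}$. *)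

theory Defs
  imports Complex_Main "HOL-Algebra.Module" "HOL-Algebra.Product_Groups"
begin

definition circle_group :: "complex monoid" where
  "circle_group = \<lparr>carrier = {z. cmod z = 1}, monoid.mult = (*), one = 1\<rparr>"

text \<open>
  Homomorphisms in \<^const>\<open>hom\<close> are unconstrained outside the carrier of the source.
  Restricting to \<^const>\<open>extensional\<close> functions makes equality of characters
  coincide with equality on \<open>R\<close>, so that \<open>R\<^sup>* = Hom(R, T)\<close> really is a group.
\<close>

definition char_group :: "('a, 'm) ring_scheme \<Rightarrow> ('a \<Rightarrow> complex) monoid" where
  "char_group R =
     \<lparr>carrier = hom (add_monoid R) circle_group \<inter> extensional (carrier R),
      monoid.mult = (\<lambda>\<chi> \<psi>. \<lambda>x\<in>carrier R. \<chi> x * \<psi> x),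
      one = (\<lambda>x\<in>carrier R. 1)\<rparr>"

definition theta :: "('a, 'm) ring_scheme \<Rightarrow> ('a \<Rightarrow> complex) \<Rightarrow> 'a \<Rightarrow> 'a \<Rightarrow> complex" where
  "theta R c x = (\<lambda>y\<in>carrier R. c (x \<otimes>\<^bsub>R\<^esub> y))"

definition generating_character :: "('a, 'm) ring_scheme \<Rightarrow> ('a \<Rightarrow> complex) \<Rightarrow> bool" where
  "generating_character R c \<longleftrightarrow>
     c \<in> hom (add_monoid R) circle_group \<and>
     theta R c \<in> iso (add_monoid R) (char_group R)"

text \<open>
  An \<open>s \<times> n\<close> matrix is an extensional function on the index set
  \<open>{1..s} \<times> {1..n}\<close>.  The record type of modules extends that of rings; the
  multiplicative fields play no role in the module structure.
\<close>

abbreviation mat_index :: "nat \<Rightarrow> nat \<Rightarrow> (nat \<times> nat) set" where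
  "mat_index s n \<equiv> {1..s} \<times> {1..n}"

definition mat_module ::
    "('a, 'm) ring_scheme \<Rightarrow> nat \<Rightarrow> nat \<Rightarrow> ('a, nat \<times> nat \<Rightarrow> 'a) module" where
  "mat_module R s n =
     \<lparr>carrier = mat_index s n \<rightarrow>\<^sub>E carrier R,
      monoid.mult = undefined, one = undefined,
      zero = (\<lambda>ij\<in>mat_index s n. \<zero>\<^bsub>R\<^esub>),
      add = (\<lambda>X Y. \<lambda>ij\<in>mat_index s n. X ij \<oplus>\<^bsub>R\<^esub> Y ij),
      smult = (\<lambda>a X. \<lambda>ij\<in>mat_index s n. a \<otimes>\<^bsub>R\<^esub> X ij)\<rparr>"

definition mat_char_group ::
    "('a, 'm) ring_scheme \<Rightarrow> nat \<Rightarrow> nat \<Rightarrow> (nat \<times> nat \<Rightarrow> 'a \<Rightarrow> complex) monoid" where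
  "mat_char_group R s n = product_group (mat_index s n) (\<lambda>_. char_group R)"

definition theta_mat ::
    "('a, 'm) ring_scheme \<Rightarrow> nat \<Rightarrow> nat \<Rightarrow> ('a \<Rightarrow> complex) \<Rightarrow>
     (nat \<times> nat \<Rightarrow> 'a) \<Rightarrow> (nat \<times> nat \<Rightarrow> 'a \<Rightarrow> complex)" where
  "theta_mat R s n c X = (\<lambda>ij\<in>mat_index s n. theta R c (X ij))"

definition bullet ::
    "nat \<Rightarrow> nat \<Rightarrow> (nat \<times> nat \<Rightarrow> 'a \<Rightarrow> complex) \<Rightarrow> (nat \<times> nat \<Rightarrow> 'a) \<Rightarrow> complex" where
  "bullet s n K X = (\<Prod>ij\<in>mat_index s n. K ij (X ij))"

definition char_dual ::
    "('a, 'm) ring_scheme \<Rightarrow> nat \<Rightarrow> nat \<Rightarrow> (nat \<times> nat \<Rightarrow> 'a) set \<Rightarrow>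
     (nat \<times> nat \<Rightarrow> 'a \<Rightarrow> complex) set" where
  "char_dual R s n P =
     {K \<in> carrier (mat_char_group R s n). \<forall>X\<in>P. bullet s n K X = 1}"

definition ring_dual ::
    "('a, 'm) ring_scheme \<Rightarrow> nat \<Rightarrow> nat \<Rightarrow> (nat \<times> nat \<Rightarrow> 'a) set \<Rightarrow>
     (nat \<times> nat \<Rightarrow> 'a) set" where
  "ring_dual R s n P =
     {X' \<in> carrier (mat_module R s n).
        \<forall>X\<in>P. (\<Oplus>\<^bsub>R\<^esub>ij\<in>mat_index s n. X' ij \<otimes>\<^bsub>R\<^esub> X ij) = \<zero>\<^bsub>R\<^esub>}"

lemma comm_group_circle_group: "comm_group circle_group"
proof (rule comm_groupI)
  fix x assume "x \<in> carrier circle_group"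
  then have "cmod (inverse x) = 1" "x \<noteq> 0"
    by (auto simp: circle_group_def norm_inverse)
  then have "cmod (inverse x) = 1" "inverse x * x = 1"
    by simp_all
  then show "\<exists>y\<in>carrier circle_group. y \<otimes>\<^bsub>circle_group\<^esub> x = \<one>\<^bsub>circle_group\<^esub>"
    by (auto simp: circle_group_def)
qed (auto simp: circle_group_def norm_mult)

lemma char_apply:
  assumes "\<chi> \<in> carrier (char_group R)" "x \<in> carrier R"
  shows "cmod (\<chi> x) = 1"
  using assms by (auto simp: char_group_def circle_group_def hom_def)

lemma comm_group_char_group:
  assumes "abelian_group R"
  shows "comm_group (char_group R)"
proof -
  interpret abelian_group R by fact
  show ?thesis
  proof (rule comm_groupI)
    fix \<chi> assume \<chi>: "\<chi> \<in> carrier (char_group R)"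
    have "(\<lambda>x\<in>carrier R. inverse (\<chi> x)) \<in> carrier (char_group R)"
      using \<chi> by (auto simp: char_group_def circle_group_def hom_def norm_inverse Pi_iff)
    moreover have "(\<lambda>x\<in>carrier R. inverse (\<chi> x)) \<otimes>\<^bsub>char_group R\<^esub> \<chi> = \<one>\<^bsub>char_group R\<^esub>"
    proof -
      have "inverse (\<chi> x) * \<chi> x = 1" if "x \<in> carrier R" for x
        using char_apply[OF \<chi> that] by (intro left_inverse) auto
      then show ?thesis by (auto simp: char_group_def fun_eq_iff)
    qed
    ultimately show "\<exists>\<psi>\<in>carrier (char_group R). \<psi> \<otimes>\<^bsub>char_group R\<^esub> \<chi> = \<one>\<^bsub>char_group R\<^esub>"
      by blast
  next
    fix \<chi> assume "\<chi> \<in> carrier (char_group R)"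
    then show "\<one>\<^bsub>char_group R\<^esub> \<otimes>\<^bsub>char_group R\<^esub> \<chi> = \<chi>"
      by (auto simp: char_group_def extensional_def fun_eq_iff)
  qed (auto simp: char_group_def circle_group_def hom_def norm_mult Pi_iff fun_eq_iff)
qed

lemma comm_group_mat_char_group:
  assumes "abelian_group R"
  shows "comm_group (mat_char_group R s n)"
proof -
  interpret C: comm_group "char_group R" by (rule comm_group_char_group) fact
  have "group (mat_char_group R s n)"
    by (simp add: mat_char_group_def C.is_group)
  then show ?thesis
    by (rule group.group_comm_groupI)
       (auto simp: mat_char_group_def PiE_iff fun_eq_iff C.m_comm)
qed

lemma module_mat_module:
  assumes "cring R"
  shows "module R (mat_module R s n)"
proof -
  interpret cring R by fact
  have "abelian_group (mat_module R s n)"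
  proof (rule abelian_groupI)
    fix X assume X: "X \<in> carrier (mat_module R s n)"
    then have "(\<lambda>ij\<in>mat_index s n. \<ominus>\<^bsub>R\<^esub> X ij) \<in> carrier (mat_module R s n)"
      by (auto simp: mat_module_def)
    moreover have "(\<lambda>ij\<in>mat_index s n. \<ominus>\<^bsub>R\<^esub> X ij) \<oplus>\<^bsub>mat_module R s n\<^esub> X
        = \<zero>\<^bsub>mat_module R s n\<^esub>"
      using X by (auto simp: mat_module_def PiE_iff fun_eq_iff l_neg)
    ultimately show "\<exists>Y\<in>carrier (mat_module R s n). Y \<oplus>\<^bsub>mat_module R s n\<^esub> X
        = \<zero>\<^bsub>mat_module R s n\<^esub>"
      by blast
  qed (auto simp: mat_module_def PiE_iff extensional_def fun_eq_iff add.m_ac)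
  then show ?thesis
    by (intro moduleI)
       (auto simp: assms mat_module_def PiE_iff extensional_def fun_eq_iff
          l_distr r_distr m_assoc)
qed

lemma subgroup_ring_dual:
  assumes "cring R" "P \<subseteq> carrier (mat_module R s n)"
  shows "subgroup (ring_dual R s n P) (add_monoid (mat_module R s n))"
proof -
  interpret cring R by fact
  interpret M: module R "mat_module R s n" by (rule module_mat_module) fact
  let ?I = "mat_index s n"
  have P: "X ij \<in> carrier R" if "X \<in> P" "ij \<in> ?I" for X ij
    using that assms(2) by (fastforce simp: mat_module_def PiE_iff)
  have C: "X ij \<in> carrier R" if "X \<in> ring_dual R s n P" "ij \<in> ?I" for X ij
    using that by (fastforce simp: ring_dual_def mat_module_def PiE_iff)
  have add: "Y \<oplus>\<^bsub>mat_module R s n\<^esub> Z \<in> ring_dual R s n P"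
    if Y: "Y \<in> ring_dual R s n P" and Z: "Z \<in> ring_dual R s n P" for Y Z
  proof -
    have "(\<Oplus>\<^bsub>R\<^esub>ij\<in>?I. (Y \<oplus>\<^bsub>mat_module R s n\<^esub> Z) ij \<otimes>\<^bsub>R\<^esub> X ij) = \<zero>\<^bsub>R\<^esub>" if X: "X \<in> P" for X
    proof -
      have "(\<Oplus>\<^bsub>R\<^esub>ij\<in>?I. (Y \<oplus>\<^bsub>mat_module R s n\<^esub> Z) ij \<otimes>\<^bsub>R\<^esub> X ij)
          = (\<Oplus>\<^bsub>R\<^esub>ij\<in>?I. Y ij \<otimes>\<^bsub>R\<^esub> X ij \<oplus>\<^bsub>R\<^esub> Z ij \<otimes>\<^bsub>R\<^esub> X ij)"
        by (intro finsum_cong') (auto simp: mat_module_def l_distr C[OF Y] C[OF Z] P[OF X])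
      also have "\<dots> = (\<Oplus>\<^bsub>R\<^esub>ij\<in>?I. Y ij \<otimes>\<^bsub>R\<^esub> X ij) \<oplus>\<^bsub>R\<^esub> (\<Oplus>\<^bsub>R\<^esub>ij\<in>?I. Z ij \<otimes>\<^bsub>R\<^esub> X ij)"
        by (intro finsum_addf) (auto simp: C[OF Y] C[OF Z] P[OF X])
      finally show ?thesis using X Y Z by (simp add: ring_dual_def)
    qed
    then show ?thesis using Y Z by (simp add: ring_dual_def)
  qed
  have zero: "\<zero>\<^bsub>mat_module R s n\<^esub> \<in> ring_dual R s n P"
  proof -
    have "(\<Oplus>\<^bsub>R\<^esub>ij\<in>?I. \<zero>\<^bsub>mat_module R s n\<^esub> ij \<otimes>\<^bsub>R\<^esub> X ij) = \<zero>\<^bsub>R\<^esub>" if "X \<in> P" for X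
      by (intro add.finprod_one_eqI) (auto simp: mat_module_def P[OF that])
    then show ?thesis by (simp add: ring_dual_def)
  qed
  have neg: "\<ominus>\<^bsub>mat_module R s n\<^esub> Y \<in> ring_dual R s n P" if Y: "Y \<in> ring_dual R s n P" for Y
  proof -
    have Yc: "Y \<in> carrier (mat_module R s n)" using Y by (simp add: ring_dual_def)
    define N where "N = (\<ominus>\<^bsub>R\<^esub> \<one>\<^bsub>R\<^esub>) \<odot>\<^bsub>mat_module R s n\<^esub> Y"
    have N: "N = \<ominus>\<^bsub>mat_module R s n\<^esub> Y"
      using Yc by (simp add: N_def M.smult_l_minus)
    have "(\<Oplus>\<^bsub>R\<^esub>ij\<in>?I. N ij \<otimes>\<^bsub>R\<^esub> X ij) = \<zero>\<^bsub>R\<^esub>" if X: "X \<in> P" for X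
    proof -
      have "(\<Oplus>\<^bsub>R\<^esub>ij\<in>?I. N ij \<otimes>\<^bsub>R\<^esub> X ij)
          = (\<Oplus>\<^bsub>R\<^esub>ij\<in>?I. (\<ominus>\<^bsub>R\<^esub> \<one>\<^bsub>R\<^esub>) \<otimes>\<^bsub>R\<^esub> (Y ij \<otimes>\<^bsub>R\<^esub> X ij))"
        by (intro finsum_cong') (auto simp: N_def mat_module_def m_assoc C[OF Y] P[OF X])
      also have "\<dots> = (\<ominus>\<^bsub>R\<^esub> \<one>\<^bsub>R\<^esub>) \<otimes>\<^bsub>R\<^esub> (\<Oplus>\<^bsub>R\<^esub>ij\<in>?I. Y ij \<otimes>\<^bsub>R\<^esub> X ij)"
        by (intro finsum_rdistr[symmetric]) (auto simp: C[OF Y] P[OF X])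
      finally show ?thesis using X Y by (simp add: ring_dual_def)
    qed
    then show ?thesis using Yc by (simp add: ring_dual_def N)
  qed
  show ?thesis
  proof (rule group.subgroupI)
    show "group (add_monoid (mat_module R s n))" by (rule M.add.is_group)
    show "ring_dual R s n P \<subseteq> carrier (add_monoid (mat_module R s n))"
      by (auto simp: ring_dual_def)
    show "ring_dual R s n P \<noteq> {}" using zero by blast
  qed (use add neg in \<open>auto simp: a_inv_def\<close>)
qed

lemma subgroup_char_dual:
  assumes "abelian_group R" "P \<subseteq> carrier (mat_module R s n)"
  shows "subgroup (char_dual R s n P) (mat_char_group R s n)"
proof -
  interpret C: comm_group "char_group R" by (rule comm_group_char_group) fact
  interpret K: comm_group "mat_char_group R s n" by (rule comm_group_mat_char_group) fact
  let ?I = "mat_index s n"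
  have P: "X ij \<in> carrier R" if "X \<in> P" "ij \<in> ?I" for X ij
    using that assms(2) by (fastforce simp: mat_module_def PiE_iff)
  have hom: "bullet s n (K \<otimes>\<^bsub>mat_char_group R s n\<^esub> L) X = bullet s n K X * bullet s n L X"
    if "X \<in> P" for K L X
    unfolding bullet_def prod.distrib[symmetric]
    by (rule prod.cong) (auto simp: mat_char_group_def char_group_def P[OF that])
  have one: "bullet s n \<one>\<^bsub>mat_char_group R s n\<^esub> X = 1" if "X \<in> P" for X
    unfolding bullet_def
    by (rule prod.neutral) (auto simp: mat_char_group_def char_group_def P[OF that])
  show ?thesis
  proof (rule K.subgroupI)
    show "char_dual R s n P \<noteq> {}" using one by (auto simp: char_dual_def)
    fix K assume K: "K \<in> char_dual R s n P"
    have "bullet s n (inv\<^bsub>mat_char_group R s n\<^esub> K) X = 1" if "X \<in> P" for X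
      using hom[OF that, of K "inv\<^bsub>mat_char_group R s n\<^esub> K"] one[OF that] K that
      by (simp add: char_dual_def)
    then show "inv\<^bsub>mat_char_group R s n\<^esub> K \<in> char_dual R s n P"
      using K by (simp add: char_dual_def)
  qed (auto simp: char_dual_def hom)
qed

end

theory Submission
  imports Defs
begin

text \<open>
  For matrices \<open>X'\<close> and \<open>X\<close> one has \<open>\<theta>\<^sub>c(X') \<bullet> X = c(\<langle>X', X\<rangle>)\<close>, where
  \<open>\<langle>X', X\<rangle> = \<Sum> x'\<^sub>i\<^sub>j x\<^sub>i\<^sub>j\<close>, so \<open>\<theta>\<^sub>c\<close> maps \<open>P\<^sup>\<or>\<close> into \<open>P\<^sup>\<bottom>\<close>.  Conversely, if
  \<open>\<theta>\<^sub>c(X') \<in> P\<^sup>\<bottom>\<close> and \<open>X \<in> P\<close>, then \<open>r X \<in> P\<close> gives \<open>c(\<langle>X', X\<rangle> r) = 1\<close> for every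
  \<open>r \<in> R\<close>.  Thus \<open>\<theta>\<^sub>c(\<langle>X', X\<rangle>)\<close> is trivial, and \<open>\<langle>X', X\<rangle> = 0\<close> by injectivity of \<open>\<theta>\<^sub>c\<close>.
\<close>

text \<open>The last assumption makes \<open>A\<close> the full preimage of \<open>B\<close>, so
  surjectivity of \<open>f\<close> puts all of \<open>B\<close> into the image of \<open>A\<close>;
  injectivity and multiplicativity are inherited. The restriction claim thereby becomes a membership
  equivalence.\<close>

lemma iso_restrict_carrier:
  assumes "f \<in> iso G H" "A \<subseteq> carrier G" "B \<subseteq> carrier H"
    and "\<And>x. x \<in> carrier G \<Longrightarrow> f x \<in> B \<longleftrightarrow> x \<in> A"
  shows "f \<in> iso (G\<lparr>carrier := A\<rparr>) (H\<lparr>carrier := B\<rparr>)"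
proof -
  have hom: "f \<in> hom G H" and bij: "bij_betw f (carrier G) (carrier H)"
    using assms(1) by (auto simp: iso_def)
  have "f ` A = B"
    using assms(2-4) bij by (fastforce simp: bij_betw_def)
  then have "bij_betw f A B"
    using bij assms(2) by (auto intro: bij_betw_subset)
  moreover have "f (x \<otimes>\<^bsub>G\<^esub> y) = f x \<otimes>\<^bsub>H\<^esub> f y" if "x \<in> A" "y \<in> A" for x y
    using that hom assms(2) by (auto intro: hom_mult)
  ultimately show ?thesis
    by (auto simp: iso_def hom_def bij_betw_def)
qed

lemma bij_betw_PiE_componentwise:
  assumes "\<And>i. i \<in> I \<Longrightarrow> bij_betw (f i) (A i) (B i)"
  shows "bij_betw (\<lambda>X. \<lambda>i\<in>I. f i (X i)) (Pi\<^sub>E I A) (Pi\<^sub>E I B)"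
\<comment> \<open>The inverse inverts each component. Elements of \<open>Pi\<^sub>E\<close> are
  undefined off \<open>I\<close>, as are the restricted functions, so both round trips are
  equalities of functions.\<close>
proof (rule bij_betw_byWitness[where f' = "\<lambda>Y. \<lambda>i\<in>I. inv_into (A i) (f i) (Y i)"])
  show "\<forall>X\<in>Pi\<^sub>E I A. (\<lambda>i\<in>I. inv_into (A i) (f i) ((\<lambda>i\<in>I. f i (X i)) i)) = X"
    using assms by (auto simp: fun_eq_iff PiE_iff extensional_def bij_betw_inv_into_left[OF assms])
  show "\<forall>Y\<in>Pi\<^sub>E I B. (\<lambda>i\<in>I. f i ((\<lambda>i\<in>I. inv_into (A i) (f i) (Y i)) i)) = Y"
    using assms by (auto simp: fun_eq_iff PiE_iff extensional_def bij_betw_inv_into_right[OF assms])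
  show "(\<lambda>X. \<lambda>i\<in>I. f i (X i)) ` Pi\<^sub>E I A \<subseteq> Pi\<^sub>E I B"
    using bij_betwE[OF assms] by (auto dest: PiE_mem)
  show "(\<lambda>Y. \<lambda>i\<in>I. inv_into (A i) (f i) (Y i)) ` Pi\<^sub>E I B \<subseteq> Pi\<^sub>E I A"
    using bij_betwE[OF bij_betw_inv_into[OF assms]] by (auto dest: PiE_mem)
qed

text \<open>Both groups are powers over the same index set with entrywise operations, so bijectivity
  and additivity are checked entry by entry.\<close>

lemma theta_mat_iso:
  assumes "theta R c \<in> iso (add_monoid R) (char_group R)"
  shows "theta_mat R s n c \<in> iso (add_monoid (mat_module R s n)) (mat_char_group R s n)"
proof -
  have hom: "theta R c \<in> hom (add_monoid R) (char_group R)"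
    and bij: "bij_betw (theta R c) (carrier R) (carrier (char_group R))"
    using assms by (auto simp: iso_def)
  have "bij_betw (theta_mat R s n c) (carrier (mat_module R s n)) (carrier (mat_char_group R s n))"
    using bij_betw_PiE_componentwise[of "mat_index s n" "\<lambda>_. theta R c", OF bij]
    by (simp add: mat_module_def mat_char_group_def theta_mat_def[abs_def])
  moreover have "theta_mat R s n c (X \<oplus>\<^bsub>mat_module R s n\<^esub> Y)
      = theta_mat R s n c X \<otimes>\<^bsub>mat_char_group R s n\<^esub> theta_mat R s n c Y"
    if "X \<in> carrier (mat_module R s n)" "Y \<in> carrier (mat_module R s n)" for X Y
    using that hom_mult[OF hom]
    by (auto simp: mat_module_def mat_char_group_def theta_mat_def PiE_iff fun_eq_iff)
  ultimately show ?thesis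
    by (auto simp: iso_def hom_def dest: bij_betwE)
qed

text \<open>This carries the sum defining \<open>ring_dual\<close> over to the product defining
  \<open>bullet\<close>; the empty index set yields the value at zero.\<close>

lemma character_finsum:
  assumes "abelian_group R" "c \<in> hom (add_monoid R) circle_group"
    and "finite I" "f \<in> I \<rightarrow> carrier R"
  shows "c (\<Oplus>\<^bsub>R\<^esub>i\<in>I. f i) = (\<Prod>i\<in>I. c (f i))"
proof -
  interpret abelian_group R by fact
  interpret T: comm_group circle_group by (rule comm_group_circle_group)
  interpret c: group_hom "add_monoid R" circle_group c
    using assms(2) by unfold_locales
  show ?thesis
    using assms(3,4)
  proof (induction I rule: finite_induct)
    case empty
    then show ?case using c.hom_one by (simp add: circle_group_def)
  next
    case (insert i I)
    then have "(\<Oplus>\<^bsub>R\<^esub>j\<in>I. f j) \<in> carrier R" "f i \<in> carrier R" "f \<in> I \<rightarrow> carrier R"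
      by auto
    then show ?case
      using insert c.hom_mult[of "f i" "\<Oplus>\<^bsub>R\<^esub>j\<in>I. f j"]
      by (simp add: circle_group_def)
  qed
qed

lemma bullet_theta_mat:
  assumes "ring R" "c \<in> hom (add_monoid R) circle_group"
    and X': "X' \<in> carrier (mat_module R s n)" and X: "X \<in> carrier (mat_module R s n)"
  shows "bullet s n (theta_mat R s n c X') X
    = c (\<Oplus>\<^bsub>R\<^esub>ij\<in>mat_index s n. X' ij \<otimes>\<^bsub>R\<^esub> X ij)"
proof -
  interpret ring R by fact
  have entries: "X' ij \<in> carrier R" "X ij \<in> carrier R" if "ij \<in> mat_index s n" for ij
    using that X X' by (fastforce simp: mat_module_def PiE_iff)+
  have "bullet s n (theta_mat R s n c X') X = (\<Prod>ij\<in>mat_index s n. c (X' ij \<otimes>\<^bsub>R\<^esub> X ij))"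
    unfolding bullet_def by (rule prod.cong) (auto simp: theta_mat_def theta_def entries)
  also have "\<dots> = c (\<Oplus>\<^bsub>R\<^esub>ij\<in>mat_index s n. X' ij \<otimes>\<^bsub>R\<^esub> X ij)"
    by (rule character_finsum[symmetric])
       (auto simp: assms(2) is_abelian_group entries)
  finally show ?thesis .
qed

lemma theta_mat_mem_char_dual_iff:
  assumes "cring R" "generating_character R c" "submodule P R (mat_module R s n)"
    and X': "X' \<in> carrier (mat_module R s n)"
  shows "theta_mat R s n c X' \<in> char_dual R s n P \<longleftrightarrow> X' \<in> ring_dual R s n P"
proof -
  interpret cring R by fact
  interpret C: comm_group "char_group R"
    by (rule comm_group_char_group) (rule is_abelian_group)
  let ?I = "mat_index s n"
  let ?pair = "\<lambda>X. \<Oplus>\<^bsub>R\<^esub>ij\<in>?I. X' ij \<otimes>\<^bsub>R\<^esub> X ij"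
  have c: "c \<in> hom (add_monoid R) circle_group"
    and iso: "theta R c \<in> iso (add_monoid R) (char_group R)"
    using assms(2) by (auto simp: generating_character_def)
  then have inj: "inj_on (theta R c) (carrier R)"
    by (auto simp: iso_def bij_betw_def)
  interpret th: group_hom "add_monoid R" "char_group R" "theta R c"
    using iso by unfold_locales (auto simp: iso_def)
  have PM: "P \<subseteq> carrier (mat_module R s n)"
    using submodule.axioms(1)[OF assms(3)] subgroup.subset by fastforce
  have smult: "r \<odot>\<^bsub>mat_module R s n\<^esub> X \<in> P" if "r \<in> carrier R" "X \<in> P" for r X
    using that submodule.smult_closed[OF assms(3)] by blast
  have entries: "X ij \<in> carrier R"
    if "X \<in> carrier (mat_module R s n)" "ij \<in> ?I" for X ij
    using that by (fastforce simp: mat_module_def PiE_iff)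
  have pair: "?pair X \<in> carrier R" if "X \<in> P" for X
    using that PM X' by (intro finsum_closed) (auto simp: entries)
  \<comment> \<open>Commutativity moves \<open>r\<close> to the right, where it becomes the argument
    of the character \<open>theta R c (?pair X)\<close>.\<close>
  have pair_smult: "?pair (r \<odot>\<^bsub>mat_module R s n\<^esub> X) = ?pair X \<otimes>\<^bsub>R\<^esub> r"
    if r: "r \<in> carrier R" and "X \<in> P" for r X
  proof -
    have X: "X \<in> carrier (mat_module R s n)" using that PM by auto
    have "?pair (r \<odot>\<^bsub>mat_module R s n\<^esub> X) = (\<Oplus>\<^bsub>R\<^esub>ij\<in>?I. (X' ij \<otimes>\<^bsub>R\<^esub> X ij) \<otimes>\<^bsub>R\<^esub> r)"
      using r by (intro finsum_cong') (auto simp: mat_module_def entries[OF X] entries[OF X'] m_ac)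
    also have "\<dots> = ?pair X \<otimes>\<^bsub>R\<^esub> r"
      using r by (intro finsum_ldistr[symmetric]) (auto simp: entries[OF X] entries[OF X'])
    finally show ?thesis .
  qed
  have bullet: "bullet s n (theta_mat R s n c X') X = c (?pair X)" if "X \<in> P" for X
    using that PM by (intro bullet_theta_mat ring_axioms c X') auto
  have one: "theta R c \<zero>\<^bsub>R\<^esub> = (\<lambda>y\<in>carrier R. 1)"
    using th.hom_one by (simp add: char_group_def)
  have carrier: "theta_mat R s n c X' \<in> carrier (mat_char_group R s n)"
    using theta_mat_iso[OF iso, of s n] X' by (auto simp: iso_def hom_def)
  show ?thesis
  proof
    assume K: "theta_mat R s n c X' \<in> char_dual R s n P"
    have "?pair X = \<zero>\<^bsub>R\<^esub>" if X: "X \<in> P" for X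
    proof -
      \<comment> \<open>The matrix in \<open>char_dual\<close> is tested against the multiple of
        \<open>X\<close> by \<open>r\<close>, which again lies in \<open>P\<close>.\<close>
      have "c (?pair X \<otimes>\<^bsub>R\<^esub> r) = 1" if "r \<in> carrier R" for r
        using K bullet[OF smult[OF that X]] smult[OF that X]
        unfolding pair_smult[OF that X] by (simp add: char_dual_def)
      \<comment> \<open>Both characters are cut off outside \<open>carrier R\<close>, so agreement
        at every \<open>r\<close> in \<open>R\<close> makes them equal.\<close>
      then have "theta R c (?pair X) = theta R c \<zero>\<^bsub>R\<^esub>"
        unfolding one by (simp add: theta_def cong: restrict_cong)
      then show ?thesis
        using inj pair[OF X] by (auto dest: inj_onD)
    qed
    then show "X' \<in> ring_dual R s n P"
      using X' by (simp add: ring_dual_def)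
  next
    assume D: "X' \<in> ring_dual R s n P"
    \<comment> \<open>Here zero is read as an empty sum, whose image is the empty product.\<close>
    have "c \<zero>\<^bsub>R\<^esub> = 1"
      using character_finsum[OF is_abelian_group c, of "{}"] by simp
    then show "theta_mat R s n c X' \<in> char_dual R s n P"
      using D carrier bullet by (simp add: char_dual_def ring_dual_def)
  qed
qed

theorem lemma6:
  fixes R :: "('a, 'm) ring_scheme"
    and c :: "'a \<Rightarrow> complex"
    and s n :: nat
    and P :: "(nat \<times> nat \<Rightarrow> 'a) set"
  assumes "cring R"
    and "finite (carrier R)"
    and "generating_character R c"
    and "s \<ge> 1" and "n \<ge> 1"
    and "submodule P R (mat_module R s n)"
  shows "theta_mat R s n c \<in> iso (add_monoid (mat_module R s n)) (mat_char_group R s n)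
       \<and> theta_mat R s n c \<in>
           iso ((add_monoid (mat_module R s n))\<lparr>carrier := ring_dual R s n P\<rparr>)
               ((mat_char_group R s n)\<lparr>carrier := char_dual R s n P\<rparr>)"
proof
  show iso: "theta_mat R s n c \<in> iso (add_monoid (mat_module R s n)) (mat_char_group R s n)"
    using assms(3) by (intro theta_mat_iso) (simp add: generating_character_def)
  show "theta_mat R s n c \<in>
      iso ((add_monoid (mat_module R s n))\<lparr>carrier := ring_dual R s n P\<rparr>)
          ((mat_char_group R s n)\<lparr>carrier := char_dual R s n P\<rparr>)"
    using theta_mat_mem_char_dual_iff[OF assms(1,3,6)]
    by (intro iso_restrict_carrier[OF iso]) (auto simp: ring_dual_def char_dual_def)
qed

end
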